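(* Let $f=h+\overline{g}\in\mathcal{H}ar(\mathbb{D})$ be such that $h$ is injective and convex in $\mathbb{D}$ and $g(z)=w(z)h(z)$, where $w\in\mathcal{B}$. Then $f$ is sense-preserving and injective in $\mathbb{D}_{1/3}$. The result is sharp, i.e. the constant $1/3$ cannot be replaced by any larger one.
   Context: $\mathbb{D}=\{z\in\mathbb{C}:|z|<1\}$ and $\mathbb{D}_r=\{z\in\mathbb{C}:|z|<r\}$ for $0<r<1$. $\mathcal{H}ar(\mathbb{D})$ is the class of harmonic mappings $f=h+\overline{g}$ in $\mathbb{D}$, where $h$ and $g$ are analytic in $\mathbb{D}$ with $h(0)=0$, $h'(0)=1$ and $g(0)=0$ (this representation of $f$ is unique). $\mathcal{B}$ is the set of all analytic functions $w$ in $\mathbb{D}$ such that $|w(z)|\le 1$ in $\mathbb{D}$. The Jacobian of $f=h+\overline{g}$ is $J_f(z)=|h'(z)|^2-|g'(z)|^2$; $f$ is sense-preserving in a domain if $J_f>0$ there. An injective analytic function $h$ is convex in $\mathbb{D}$ if $h(\mathbb{D})$ is a convex set.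
   Formalization: The formal statement additionally assumes that w is not a constant of modulus 1, in both the main claim and the sharpness examples; for such w (e.g. h(z)=z, w=1, f=2 Re z) the Jacobian vanishes identically and the claim fails. *)

theory Defs
  imports "HOL-Complex_Analysis.Complex_Analysis"
begin

text \<open>
  The unit disk is \<^term>\<open>ball (0::complex) 1\<close> and the disk of radius \<open>r\<close> about the origin is
  \<^term>\<open>ball (0::complex) r\<close>. Functions are total in HOL; only their values on the unit disk matter.
\<close>

text \<open>
  \<open>Har_rep f h g\<close> says that \<open>f\<close> lies in the class Har(D) and that \<open>f = h + cnj g\<close> is its
  canonical representation, which is unique on the unit disk.
\<close>

definition Har_rep ::
  "(complex \<Rightarrow> complex) \<Rightarrow> (complex \<Rightarrow> complex) \<Rightarrow> (complex \<Rightarrow> complex) \<Rightarrow> bool" where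
  "Har_rep f h g \<longleftrightarrow>
     h holomorphic_on ball 0 1 \<and> g holomorphic_on ball 0 1 \<and>
     h 0 = 0 \<and> deriv h 0 = 1 \<and> g 0 = 0 \<and>
     (\<forall>z\<in>ball 0 1. f z = h z + cnj (g z))"

definition bounded_class :: "(complex \<Rightarrow> complex) set" where
  "bounded_class = {w. w holomorphic_on ball 0 1 \<and> (\<forall>z\<in>ball 0 1. cmod (w z) \<le> 1)}"

definition convex_map :: "(complex \<Rightarrow> complex) \<Rightarrow> bool" where
  "convex_map h \<longleftrightarrow>
     h holomorphic_on ball 0 1 \<and> inj_on h (ball 0 1) \<and> convex (h ` ball 0 1)"

text \<open>The Jacobian of \<open>f = h + cnj g\<close>, given through the analytic parts \<open>h\<close> and \<open>g\<close> of \<open>f\<close>.\<close>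

definition harmonic_jacobian ::
  "(complex \<Rightarrow> complex) \<Rightarrow> (complex \<Rightarrow> complex) \<Rightarrow> complex \<Rightarrow> real" where
  "harmonic_jacobian h g z = (cmod (deriv h z))\<^sup>2 - (cmod (deriv g z))\<^sup>2"

definition sense_preserving_on ::
  "(complex \<Rightarrow> complex) \<Rightarrow> (complex \<Rightarrow> complex) \<Rightarrow> complex set \<Rightarrow> bool" where
  "sense_preserving_on h g S \<longleftrightarrow> (\<forall>z\<in>S. harmonic_jacobian h g z > 0)"

text \<open>
  For a unimodular constant \<open>w\<close> and \<open>g = w h\<close> the Jacobian of \<open>h + cnj g\<close> vanishes identically,
  and \<open>h + cnj g\<close> maps into a line. This degenerate case (the only one in which the bound
  \<open>cmod (w z) \<le> 1\<close> is attained in the disk) has to be excluded.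
\<close>

definition unimodular_const :: "(complex \<Rightarrow> complex) \<Rightarrow> bool" where
  "unimodular_const w \<longleftrightarrow> (\<exists>c. cmod c = 1 \<and> (\<forall>z\<in>ball 0 1. w z = c))"

end

theory Submission imports Defs begin

text \<open>
  From \<open>g = w h\<close> one has \<open>g' / h' = w + w' (h / h')\<close>. Two estimates control the right-hand side
  at \<open>|z| = r\<close>: the Schwarz--Pick inequality \<open>|w'| \<le> (1 - |w|\<^sup>2) / (1 - r\<^sup>2)\<close>
  (\<open>Schwarz_Pick\<close>) and, because \<open>h\<close> is convex, \<open>|h / h'| \<le> r (1 + r)\<close>
  (\<open>convex_map_quotient_bound\<close>). Together they give
  \<open>|g' / h'| \<le> |w| + (1 - |w|\<^sup>2) r / (1 - r)\<close>. For \<open>r < 1/3\<close> the last factor is below \<open>1/2\<close>, and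
  \<open>|w| + (1 - |w|\<^sup>2) / 2 \<le> 1\<close>; so \<open>|g'| < |h'|\<close>, which is preservation of sense.

  Injectivity follows from the same inequality by passing to the variable \<open>u = h z\<close>. There \<open>f\<close>
  becomes \<open>u + cnj (G u)\<close> with \<open>|G'| < 1\<close>, on the domain \<open>h(D_r)\<close>. That domain is convex (a theorem
  of Study, \<open>convex_map_image_ball_convex\<close>), so integrating \<open>G'\<close> over segments shows that \<open>G\<close>
  strictly decreases distances, and \<open>u + cnj (G u)\<close> cannot take a value twice.

  The facts on convex maps all come from one application of the Schwarz lemma
  (\<open>convex_map_Schwarz\<close>): for \<open>|x| \<le> 1\<close>, moving \<open>h z\<close> towards \<open>h (x z)\<close> along a segment and
  pulling back by the inverse of \<open>h\<close> does not increase the modulus of the point. Study's theorem is immediate.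
  The initial velocity of the motion gives \<open>Re ((h z - h (x z)) / (z h' z)) \<ge> 0\<close>, and a maximum
  principle in the variable \<open>x\<close> sharpens this to the Marx--Strohhaecker inequality
  \<open>Re (z h' / h) \<ge> 1/2\<close>. The latter says \<open>|h / (z h') - 1| \<le> 1\<close>, and the Schwarz lemma replaces
  the bound \<open>1\<close> by \<open>|z|\<close>.

  Sharpness comes from making both estimates equalities at the same point \<open>z = -s\<close> with \<open>s > 1/3\<close>:
  \<open>h = z / (1 - z)\<close> maps the disk onto a half-plane, and \<open>w\<close> is a disk automorphism with real
  coefficients for which \<open>w\<close> and \<open>w' (h / h')\<close> are both positive at \<open>-s\<close>. As \<open>w (-s)\<close> approaches \<open>1\<close>, the
  Jacobian at \<open>-s\<close> becomes negative.
\<close>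

section \<open>Univalent maps with convex image\<close>

lemma convex_map_regular:
  assumes "convex_map h" "cmod z < 1"
  shows "deriv h z \<noteq> 0"
  using assms holomorphic_injective_imp_regular[of h "ball 0 1" z]
  unfolding convex_map_def by auto

lemma convex_map_open_image:
  assumes "convex_map h" "r \<le> 1"
  shows "open (h ` ball 0 r)"
proof (rule open_mapping_thm3)
  show "h holomorphic_on ball 0 r" "inj_on h (ball 0 r)"
    using assms holomorphic_on_subset inj_on_subset unfolding convex_map_def
    by (meson subset_ball)+
qed auto

lemma convex_map_inverse:
  assumes "convex_map h"
  obtains k where "k holomorphic_on h ` ball 0 1" "\<And>z. z \<in> ball 0 1 \<Longrightarrow> k (h z) = z"
    "\<And>z. z \<in> ball 0 1 \<Longrightarrow> deriv h z * deriv k (h z) = 1"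
  using holomorphic_has_inverse[of h "ball 0 1"] assms unfolding convex_map_def
  by (metis open_ball)

text \<open>
  Convexity makes \<open>\<psi> z = (1 - t) h z + t h (x z)\<close> a map of the disk into the image of \<open>h\<close>. Hence
  \<open>k \<circ> \<psi>\<close>, with \<open>k\<close> the inverse of \<open>h\<close>, is a self-map of the disk that fixes the origin, and the
  Schwarz lemma applies.
\<close>
lemma convex_map_Schwarz:
  assumes h: "convex_map h" "h 0 = 0"
    and k: "k holomorphic_on h ` ball 0 1" "\<And>z. z \<in> ball 0 1 \<Longrightarrow> k (h z) = z"
    and x: "cmod x \<le> 1" and t: "0 \<le> t" "t \<le> 1" and z: "cmod z < 1"
  shows "h z + of_real t * (h (x * z) - h z) \<in> h ` ball 0 1"
    and "cmod (k (h z + of_real t * (h (x * z) - h z))) \<le> cmod z"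
proof -
  define \<psi> where "\<psi> = (\<lambda>z. h z + of_real t * (h (x * z) - h z))"
  have xz: "cmod (x * z) < 1" if "cmod z < 1" for z
    using that x mult_mono[of "cmod x" 1 "cmod z" "cmod z"] by (simp add: norm_mult)
  have \<psi>_in: "\<psi> z \<in> h ` ball 0 1" if "cmod z < 1" for z
  proof -
    have "(1 - t) *\<^sub>R h z + t *\<^sub>R h (x * z) \<in> h ` ball 0 1"
      using h(1) that xz[OF that] t unfolding convex_map_def by (intro convexD) auto
    then show ?thesis
      by (simp add: \<psi>_def scaleR_conv_of_real algebra_simps)
  qed
  then show "h z + of_real t * (h (x * z) - h z) \<in> h ` ball 0 1"
    using z unfolding \<psi>_def by blast
  have holh: "h holomorphic_on ball 0 1"
    using h(1) by (simp add: convex_map_def)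
  have "(\<lambda>z. h (x * z)) holomorphic_on ball 0 1"
    using holomorphic_on_compose_gen[of "\<lambda>z. x * z" "ball 0 1" h "ball 0 1"] holh xz
    by (force simp: o_def intro!: holomorphic_intros)
  then have "\<psi> holomorphic_on ball 0 1"
    unfolding \<psi>_def using holh by (intro holomorphic_intros)
  then have hol: "(\<lambda>z. k (\<psi> z)) holomorphic_on ball 0 1"
    using holomorphic_on_compose_gen[OF _ k(1), of \<psi> "ball 0 1"] \<psi>_in by (force simp: o_def)
  have "k (\<psi> 0) = 0"
    using k(2)[of 0] by (simp add: \<psi>_def h(2))
  moreover have "cmod (k (\<psi> z)) < 1" if "cmod z < 1" for z
    using \<psi>_in[OF that] k(2) by auto
  ultimately show "cmod (k (h z + of_real t * (h (x * z) - h z))) \<le> cmod z"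
    using Schwarz_Lemma(1)[OF hol] z unfolding \<psi>_def by blast
qed

text \<open>
  Study's theorem. Given two points of the smaller disk, the one of smaller modulus is \<open>x\<close> times the
  other one for some \<open>|x| \<le> 1\<close>, so the preceding lemma keeps the preimage of the segment
  between their images inside that disk.
\<close>
lemma convex_map_image_ball_convex:
  assumes h: "convex_map h" "h 0 = 0" and r: "r \<le> 1"
  shows "convex (h ` ball 0 r)"
proof -
  obtain k where k: "k holomorphic_on h ` ball 0 1" "\<And>z. z \<in> ball 0 1 \<Longrightarrow> k (h z) = z"
    and k': "\<And>z. z \<in> ball 0 1 \<Longrightarrow> deriv h z * deriv k (h z) = 1"
    using convex_map_inverse[OF h(1)] by blast
  have *: "h a + of_real t * (h b - h a) \<in> h ` ball 0 r"
    if "cmod b \<le> cmod a" "cmod a < r" "0 \<le> t" "t \<le> 1" for a b t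
  proof -
    have x: "cmod (b / a) \<le> 1" "b / a * a = b"
      using that(1) by (auto simp: norm_divide divide_le_eq_1)
    have a1: "cmod a < 1" using that r by simp
    note S = convex_map_Schwarz[OF h k x(1) that(3,4) a1, unfolded x(2)]
    from S(1) obtain u where u: "u \<in> ball 0 1" "h a + of_real t * (h b - h a) = h u"
      by blast
    then have "cmod u \<le> cmod a" using S(2) k(2) by metis
    with u that show ?thesis by auto
  qed
  show ?thesis
  proof (rule convexI)
    fix p q :: complex and u v :: real
    assume p: "p \<in> h ` ball 0 r" and q: "q \<in> h ` ball 0 r" and uv: "0 \<le> u" "0 \<le> v" "u + v = 1"
    from p q obtain a b where ab: "cmod a < r" "p = h a" "cmod b < r" "q = h b" by auto
    have u: "u = 1 - v" using uv by simp
    have "u *\<^sub>R p + v *\<^sub>R q = h a + of_real v * (h b - h a)"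
      "u *\<^sub>R p + v *\<^sub>R q = h b + of_real u * (h a - h b)"
      unfolding ab u by (simp_all add: scaleR_conv_of_real algebra_simps)
    then show "u *\<^sub>R p + v *\<^sub>R q \<in> h ` ball 0 r"
      using *[of b a v] *[of a b u] ab uv by (cases "cmod b \<le> cmod a") auto
  qed
qed

text \<open>
  The curve \<open>t \<mapsto> k (h z + t c)\<close> with \<open>c = h (x z) - h z\<close> starts at \<open>z\<close> and stays in the closed disk of
  radius \<open>|z|\<close>. Its initial velocity \<open>c / h' z\<close> therefore does not point out of that disk, that is,
  \<open>Re (cnj z * c / h' z) \<le> 0\<close>.
\<close>
lemma convex_map_rotation_Re_nonneg:
  assumes h: "convex_map h" "h 0 = 0" and x: "cmod x \<le> 1" and z: "cmod z < 1"
  shows "0 \<le> Re ((h z - h (x * z)) / (z * deriv h z))"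
proof -
  obtain k where k: "k holomorphic_on h ` ball 0 1" "\<And>z. z \<in> ball 0 1 \<Longrightarrow> k (h z) = z"
    and k': "\<And>z. z \<in> ball 0 1 \<Longrightarrow> deriv h z * deriv k (h z) = 1"
    using convex_map_inverse[OF h(1)] by blast
  define c where "c = h (x * z) - h z"
  have zD: "z \<in> ball 0 1" using z by simp
  have dk: "deriv k (h z) = 1 / deriv h z"
    using k'[OF zD] convex_map_regular[OF h(1) z] by (simp add: nonzero_eq_divide_eq mult.commute)
  have "(k has_field_derivative 1 / deriv h z) (at (h z))"
    using holomorphic_derivI[OF k(1) convex_map_open_image[OF h(1) order_refl]] zD
    by (metis dk imageI)
  then have D: "((\<lambda>s. k (h z + s * c)) has_field_derivative 1 / deriv h z * c) (at (of_real 0))"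
    by (intro DERIV_chain2[where f = k]) (auto intro!: derivative_eq_intros)
  have DR: "((\<lambda>t. Re (cnj z * k (h z + of_real t * c))) has_real_derivative
      Re (cnj z * (1 / deriv h z * c))) (at 0)"
  proof -
    have "((\<lambda>t. k (h z + of_real t * c)) has_vector_derivative (1 / deriv h z * c)) (at 0)"
      by (rule has_vector_derivative_real_field[OF D])
    then have "((\<lambda>t. cnj z * k (h z + of_real t * c)) has_vector_derivative
        cnj z * (1 / deriv h z * c)) (at 0)"
      by (rule has_vector_derivative_mult_right)
    then show ?thesis
      using has_field_derivative_Re by blast
  qed
  have "Re (cnj z * (1 / deriv h z * c)) \<le> 0"
  proof (rule ccontr)
    assume "\<not> ?thesis"
    then obtain d where d: "d > 0" "\<And>t. 0 < t \<Longrightarrow> t < d \<Longrightarrow>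
        Re (cnj z * k (h z)) < Re (cnj z * k (h z + of_real t * c))"
      using DERIV_pos_inc_right[OF DR] by auto
    define t where "t = min 1 (d / 2)"
    have t: "0 < t" "t < d" "t \<le> 1" using d(1) by (auto simp: t_def)
    have "Re (cnj z * k (h z + of_real t * c)) \<le> cmod (cnj z * k (h z + of_real t * c))"
      by (rule complex_Re_le_cmod)
    also have "\<dots> \<le> cmod z * cmod z"
      using convex_map_Schwarz(2)[OF h k x less_imp_le[OF t(1)] t(3) z]
      by (simp add: norm_mult c_def mult_left_mono)
    also have "\<dots> = Re (cnj z * k (h z))"
      using k(2)[OF zD] by (simp add: cmod_def power2_eq_square flip: real_sqrt_mult)
    finally show False using d(2)[OF t(1,2)] by simp
  qed
  moreover have "(h z - h (x * z)) / (z * deriv h z)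
      = - (cnj z * (1 / deriv h z * c)) / of_real ((cmod z)\<^sup>2)"
    unfolding complex_norm_square c_def
    using convex_map_regular[OF h(1) z] by (cases "z = 0") (simp_all add: field_simps)
  ultimately show ?thesis
    by (simp only: Re_divide_of_real uminus_complex.simps)
      (intro divide_nonneg_nonneg, simp_all only: neg_0_le_iff_le zero_le_power2)
qed

lemma Re_one_plus_div_one_minus:
  assumes "cmod x = 1"
  shows "Re ((1 + x) / (1 - x)) = 0"
proof -
  have "(Re x)\<^sup>2 + (Im x)\<^sup>2 = 1" using assms by (metis cmod_power2 one_power2)
  then show ?thesis
    by (simp add: Re_divide algebra_simps power2_eq_square)
qed

text \<open>
  For fixed \<open>z\<close>, consider \<open>2 z h' z / (h z - h (x z)) - (1 + x) / (1 - x)\<close> as a function of \<open>x\<close>.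
  On the unit circle the first term has nonnegative real part, being \<open>2\<close> divided by the quotient in
  \<open>convex_map_rotation_Re_nonneg\<close>, and the second one is purely imaginary. The poles of the two terms at \<open>x = 1\<close> cancel, so the function
  is holomorphic near the closed disk, and by the maximum principle its real part is
  nonnegative at \<open>x = 0\<close>, where its value is \<open>2 z h' z / h z - 1\<close>.
\<close>
lemma convex_map_Marx_Strohhaecker:
  assumes h: "convex_map h" "h 0 = 0" and z: "cmod z < 1" "z \<noteq> 0"
  shows "1 \<le> Re (2 * z * deriv h z / h z)"
proof -
  \<comment> \<open>\<open>q\<close> and \<open>G\<close> are difference quotients with the removable singularity at \<open>1\<close> filled in;
      \<open>G\<close> is the negative of the function described above.\<close>
  define S where "S = ball (0::complex) (1 / cmod z)"
  define p where "p = (\<lambda>x. h (x * z))"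
  define q where "q = (\<lambda>x. if x = 1 then deriv p 1 else (p x - p 1) / (x - 1))"
  define N where "N = (\<lambda>x. 2 * z * deriv h z / q x - (1 + x))"
  define G where "G = (\<lambda>x. if x = 1 then deriv N 1 else (N x - N 1) / (x - 1))"
  have holh: "h holomorphic_on ball 0 1" and inj: "inj_on h (ball 0 1)"
    using h(1) by (auto simp: convex_map_def)
  have oS: "open S" by (simp add: S_def)
  have SD: "x * z \<in> ball 0 1" if "x \<in> S" for x
    using that z by (simp add: S_def norm_mult field_simps)
  have cS: "cball 0 1 \<subseteq> S"
  proof
    fix x :: complex assume "x \<in> cball 0 1"
    then have "cmod x * cmod z \<le> 1 * cmod z"
      by (intro mult_right_mono) auto
    then have "cmod x * cmod z < 1" using z by linarith
    with z show "x \<in> S" by (simp add: S_def field_simps)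
  qed
  have h'z: "deriv h z \<noteq> 0" using convex_map_regular[OF h(1) z(1)] .
  have holp: "p holomorphic_on S"
    unfolding p_def using holomorphic_on_compose_gen[of "\<lambda>x. x * z" S h "ball 0 1"] holh SD
    by (force simp: o_def intro!: holomorphic_intros)
  have "(h has_field_derivative deriv h z) (at (1 * z))"
    using holomorphic_derivI[OF holh, of z] z by simp
  then have "(p has_field_derivative deriv h z * z) (at 1)"
    unfolding p_def by (rule DERIV_chain2) (auto intro!: derivative_eq_intros)
  then have p'1: "deriv p 1 = deriv h z * z" by (rule DERIV_imp_deriv)
  have holq: "q holomorphic_on S"
    unfolding q_def by (rule pole_lemma_open[OF holp oS])
  have q0: "q x \<noteq> 0" if "x \<in> S" for x
  proof (cases "x = 1")
    case False
    have "1 * z \<in> ball 0 1" using z by simp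
    then have "h (x * z) \<noteq> h (1 * z)"
      using inj SD[OF that] False z(2) by (metis inj_onD mult_cancel_right)
    with False show ?thesis by (simp add: q_def p_def)
  qed (use h'z z in \<open>simp add: q_def p'1\<close>)
  have holN: "N holomorphic_on S"
    unfolding N_def by (intro holomorphic_intros holq) (use q0 in auto)
  have N1: "N 1 = 0"
    using h'z z by (simp add: N_def q_def p'1)
  have holG: "G holomorphic_on S"
    unfolding G_def by (rule pole_lemma_open[OF holN oS])
  have G: "G x = (1 + x) / (1 - x) - 2 * z * deriv h z / (h z - h (x * z))" if "x \<noteq> 1" for x
  proof -
    have "G x = N x / (x - 1)"
      using that by (simp add: G_def N1)
    also have "\<dots> = 2 * z * deriv h z / (h (x * z) - h z) - (1 + x) / (x - 1)"
      unfolding N_def diff_divide_distrib[of _ "1 + x"] using that by (simp add: q_def p_def)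
    also have "\<dots> = (1 + x) / (1 - x) - 2 * z * deriv h z / (h z - h (x * z))"
      using minus_divide_right[of "1 + x" "1 - x"]
        minus_divide_right[of "2 * z * deriv h z" "h z - h (x * z)"]
      by (metis (no_types) minus_diff_eq minus_divide_right diff_minus_eq_add add.commute
          uminus_add_conv_diff)
    finally show ?thesis .
  qed
  have contG: "continuous_on (cball 0 1) G"
    using holG cS holomorphic_on_imp_continuous_on holomorphic_on_subset by blast
  have le: "Re (G x) \<le> 0" if "x \<in> sphere 0 1 - {1}" for x
  proof -
    define Q where "Q = (h z - h (x * z)) / (z * deriv h z)"
    have "0 \<le> Re Q"
      using convex_map_rotation_Re_nonneg[OF h _ z(1), of x] that by (simp add: Q_def)
    then have "0 \<le> Re (2 / Q)"
      by (simp add: Re_divide)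
    moreover have "2 / Q = 2 * z * deriv h z / (h z - h (x * z))"
      by (simp add: Q_def)
    ultimately show ?thesis
      using G[of x] Re_one_plus_div_one_minus[of x] that by auto
  qed
  \<comment> \<open>The point \<open>x = 1\<close>, where the sign of \<open>Re G\<close> is not known directly, is reached by continuity.\<close>
  have le': "Re (G x) \<le> 0" if "x \<in> sphere 0 1" for x
  proof -
    have "(1::complex) islimpt sphere 0 1"
    proof (rule connected_imp_perfect)
      show "connected (sphere (0::complex) 1)" by (rule connected_sphere) simp
      show "sphere (0::complex) 1 \<noteq> {y}" for y
      proof
        assume "sphere (0::complex) 1 = {y}"
        moreover have "1 \<in> sphere (0::complex) 1" "-1 \<in> sphere (0::complex) 1" by auto
        ultimately have "(1::complex) = -1" by (metis singletonD)
        then show False by simp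
      qed
    qed simp
    then have "x \<in> closure (sphere 0 1 - {1})"
      using that by (metis DiffI closure_subset islimpt_in_closure singletonD subsetD)
    moreover have "closure (sphere (0::complex) 1 - {1}) \<subseteq> cball 0 1"
      by (rule closure_minimal) auto
    ultimately show ?thesis
      using continuous_le_on_closure[of "sphere 0 1 - {1}" "\<lambda>x. Re (G x)" x 0] le
        continuous_on_subset[OF contG] by (auto intro!: continuous_intros)
  qed
  have "Re (G 0) \<le> 0"
  proof (rule maximum_real_frontier[of G "cball 0 1"])
    show "G holomorphic_on interior (cball 0 1)"
      using holG cS holomorphic_on_subset interior_subset by blast
    show "continuous_on (closure (cball 0 1)) G" using contG by simp
    show "Re (G x) \<le> 0" if "x \<in> frontier (cball 0 1)" for x
      using that le' by simp
  qed auto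
  then show ?thesis
    using G[of 0] h(2) by simp
qed

text \<open>
  The function \<open>p = h / (z h') - 1\<close> vanishes at the origin, and \<open>Re (z h' / h) \<ge> 1/2\<close> is the same as
  \<open>|p| \<le> 1\<close>. The Schwarz lemma improves this to \<open>|p z| \<le> |z|\<close>.
\<close>
lemma convex_map_quotient_bound:
  assumes h: "convex_map h" "h 0 = 0" and z: "cmod z < 1"
  shows "cmod (h z) \<le> cmod z * (1 + cmod z) * cmod (deriv h z)"
proof -
  have holh: "h holomorphic_on ball 0 1"
    using h(1) by (simp add: convex_map_def)
  obtain H where H: "H holomorphic_on ball 0 1" "\<And>z. cmod z < 1 \<Longrightarrow> h z = z * H z"
    "deriv h 0 = H 0"
    using Schwarz3[OF holh h(2)] by blast
  define p where "p = (\<lambda>z. H z / deriv h z - 1)"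
  note h'0 = convex_map_regular[OF h(1)]
  have "deriv h holomorphic_on ball 0 1"
    by (rule holomorphic_deriv[OF holh open_ball])
  then have holp: "p holomorphic_on ball 0 1"
    unfolding p_def by (intro holomorphic_on_diff holomorphic_on_divide H holomorphic_on_const)
      (use h'0 in auto)
  have p0: "p 0 = 0"
    using H(3) h'0[of 0] by (simp add: p_def)
  have p1: "cmod (p z) \<le> 1" if z: "cmod z < 1" for z
  proof (cases "z = 0")
    case False
    define u where "u = H z / deriv h z"
    have "1 \<le> Re (2 * z * deriv h z / h z)"
      by (rule convex_map_Marx_Strohhaecker[OF h z False])
    also have "2 * z * deriv h z / h z = 2 / u"
      using H(2)[OF z] False by (simp add: u_def)
    finally have u: "1 \<le> Re (2 / u)" .
    then have "u \<noteq> 0" by auto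
    then have "(Re u)\<^sup>2 + (Im u)\<^sup>2 > 0"
      by (metis complex_eq_0 not_sum_power2_lt_zero linorder_neqE_linordered_idom)
    with u have "(Re u)\<^sup>2 + (Im u)\<^sup>2 \<le> 2 * Re u"
      by (simp add: Re_divide field_simps power2_eq_square)
    then have "(cmod (u - 1))\<^sup>2 \<le> 1"
      unfolding cmod_power2 by (simp add: power2_eq_square algebra_simps)
    then show ?thesis
      by (simp add: p_def u_def power2_le_iff_abs_le abs_square_le_1)
  qed (simp add: p0)
  have p2: "cmod (p z) < 1" if z: "cmod z < 1" for z
  proof (rule ccontr)
    assume "\<not> ?thesis"
    then have "cmod (p y) \<le> cmod (p z)" if "y \<in> ball 0 1" for y
      using p1[of y] that by auto
    then have "p constant_on ball 0 1"
      using maximum_modulus_principle[OF holp _ _ _ order_refl, of z] z by auto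
    then have "p z = p 0"
      using z unfolding constant_on_def by auto
    with p0 \<open>\<not> ?thesis\<close> show False by simp
  qed
  have "cmod (p z) \<le> cmod z"
    by (rule Schwarz_Lemma(1)[OF holp p0 p2 z])
  then have "cmod (1 + p z) \<le> 1 + cmod z"
    using norm_triangle_ineq[of 1 "p z"] by simp
  moreover have "h z = z * (1 + p z) * deriv h z"
    using H(2)[OF z] h'0[OF z] by (simp add: p_def)
  ultimately show ?thesis
    by (simp add: norm_mult mult_left_mono mult_right_mono)
qed

section \<open>Holomorphic self-maps of the disk\<close>

lemma Moebius_function_has_derivative:
  assumes "1 - cnj a * z \<noteq> 0"
  shows "(Moebius_function 0 a has_field_derivative
      of_real (1 - (cmod a)\<^sup>2) / (1 - cnj a * z)\<^sup>2) (at z)"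
proof -
  have "((\<lambda>z. (z - a) / (1 - cnj a * z)) has_field_derivative
      of_real (1 - (cmod a)\<^sup>2) / (1 - cnj a * z)\<^sup>2) (at z)"
    using assms unfolding of_real_diff complex_norm_square
    by (auto intro!: derivative_eq_intros simp: field_simps power2_eq_square)
  then show ?thesis
    by (simp add: Moebius_function_simple[abs_def])
qed

text \<open>
  Composing \<open>w\<close> with disk automorphisms that move \<open>0\<close> to \<open>z\<close> and \<open>w z\<close> to \<open>0\<close> reduces the claim
  to the bound on the derivative at the origin in the Schwarz lemma.
\<close>
lemma Schwarz_Pick:
  assumes w: "w holomorphic_on ball 0 1" and w1: "\<And>z. cmod z < 1 \<Longrightarrow> cmod (w z) < 1"
    and z: "cmod z < 1"
  shows "cmod (deriv w z) * (1 - (cmod z)\<^sup>2) \<le> 1 - (cmod (w z))\<^sup>2"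
proof -
  let ?M = "Moebius_function 0"
  define \<phi> where "\<phi> = (\<lambda>\<zeta>. ?M (w z) (w (?M (-z) \<zeta>)))"
  have M1: "cmod (?M (-z) \<zeta>) < 1" if "cmod \<zeta> < 1" for \<zeta>
    using Moebius_function_norm_lt_1[of "-z" \<zeta>] z that by simp
  have hol1: "(w \<circ> ?M (-z)) holomorphic_on ball 0 1"
    using M1 z by (intro holomorphic_on_compose_gen[OF _ w] Moebius_function_holomorphic) auto
  have hol: "\<phi> holomorphic_on ball 0 1"
    using holomorphic_on_compose_gen[OF hol1 Moebius_function_holomorphic[OF w1[OF z]], of 0] M1 w1
    by (force simp: o_def \<phi>_def)
  have M0: "?M (-z) 0 = z" by (simp add: Moebius_function_of_zero)
  have "\<phi> 0 = 0"
    by (simp add: \<phi>_def M0 Moebius_function_eq_zero)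
  moreover have "cmod (\<phi> \<zeta>) < 1" if "cmod \<zeta> < 1" for \<zeta>
    unfolding \<phi>_def using that by (intro Moebius_function_norm_lt_1 w1 M1 z)
  ultimately have le: "cmod (deriv \<phi> 0) \<le> 1"
    using Schwarz_Lemma(2)[OF hol] by (metis norm_zero zero_less_one)
  define A where "A = 1 - (cmod (w z))\<^sup>2"
  have A: "A > 0" using w1[OF z] by (simp add: A_def abs_square_less_1)
  have Z: "1 - (cmod z)\<^sup>2 > 0" using z by (simp add: abs_square_less_1)
  have Ac: "1 - cnj (w z) * w z = of_real A"
    unfolding A_def of_real_diff complex_norm_square by simp
  have d1: "(?M (-z) has_field_derivative of_real (1 - (cmod z)\<^sup>2)) (at 0)"
    using Moebius_function_has_derivative[of "-z" 0] by simp
  have d2: "(w has_field_derivative deriv w z) (at (?M (-z) 0))"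
    unfolding M0 using holomorphic_derivI[OF w, of z] z by simp
  have d3: "(?M (w z) has_field_derivative 1 / of_real A) (at (w (?M (-z) 0)))"
    unfolding M0 using Moebius_function_has_derivative[of "w z" "w z", unfolded Ac, folded A_def] A
    by (simp add: power2_eq_square)
  have "(\<phi> has_field_derivative 1 / of_real A * (deriv w z * of_real (1 - (cmod z)\<^sup>2))) (at 0)"
    unfolding \<phi>_def by (rule DERIV_chain2[OF d3 DERIV_chain2[OF d2 d1]])
  then have "deriv \<phi> 0 = 1 / of_real A * (deriv w z * of_real (1 - (cmod z)\<^sup>2))"
    by (rule DERIV_imp_deriv)
  then have "cmod (deriv \<phi> 0) = cmod (deriv w z) * (1 - (cmod z)\<^sup>2) / A"
    using A Z by (simp only: norm_mult norm_divide norm_of_real norm_one) simp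
  with le A show ?thesis by (simp add: A_def)
qed

lemma bounded_class_norm_less_1:
  assumes w: "w \<in> bounded_class" "\<not> unimodular_const w" and z: "cmod z < 1"
  shows "cmod (w z) < 1"
proof (rule ccontr)
  assume n: "\<not> ?thesis"
  have hol: "w holomorphic_on ball 0 1" and le: "\<And>y. cmod y < 1 \<Longrightarrow> cmod (w y) \<le> 1"
    using w(1) by (auto simp: bounded_class_def)
  have eq: "cmod (w z) = 1" using n le[OF z] by simp
  have "w constant_on ball 0 1"
    using maximum_modulus_principle[OF hol _ _ _ order_refl, of z] z le eq by auto
  then obtain c where c: "\<And>y. y \<in> ball 0 1 \<Longrightarrow> w y = c"
    unfolding constant_on_def by auto
  with eq z have "unimodular_const w"
    unfolding unimodular_const_def by (metis dist_0_norm mem_ball)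
  with w(2) show False ..
qed

section \<open>Preservation of sense and injectivity\<close>

text \<open>
  The constant \<open>1/3\<close> enters here, as the solution of \<open>r / (1 - r) = 1 / 2\<close>: the bound
  \<open>|w| + (1 - |w|\<^sup>2) r / (1 - r)\<close> for \<open>|g' / h'|\<close> is less than \<open>1\<close> for all \<open>|w| < 1\<close> if and only if
  \<open>r / (1 - r) \<le> 1 / 2\<close>.
\<close>
lemma deriv_product_less_deriv:
  assumes h: "convex_map h" "h 0 = 0"
    and w: "w holomorphic_on ball 0 1" "\<And>z. cmod z < 1 \<Longrightarrow> cmod (w z) < 1"
    and g: "\<And>z. cmod z < 1 \<Longrightarrow> g z = w z * h z"
    and z: "cmod z < 1 / 3"
  shows "cmod (deriv g z) < cmod (deriv h z)"
proof -
  define r where "r = cmod z"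
  define a where "a = cmod (w z)"
  define d where "d = cmod (deriv h z)"
  have r: "0 \<le> r" "r < 1 / 3" and z1: "cmod z < 1" using z by (auto simp: r_def)
  have a: "0 \<le> a" "a < 1" using w(2)[OF z1] by (auto simp: a_def)
  have d: "d > 0" using convex_map_regular[OF h(1) z1] by (simp add: d_def)
  have holh: "h holomorphic_on ball 0 1"
    using h(1) by (simp add: convex_map_def)
  have "((\<lambda>z. w z * h z) has_field_derivative deriv w z * h z + deriv h z * w z) (at z)"
    using z1 by (intro DERIV_mult holomorphic_derivI[OF w(1)] holomorphic_derivI[OF holh]) auto
  then have "(g has_field_derivative deriv w z * h z + deriv h z * w z) (at z)"
    by (rule has_field_derivative_transform_within_open[of _ _ _ "ball 0 1"]) (use g z1 in auto)
  then have "cmod (deriv g z) \<le> cmod (deriv w z) * cmod (h z) + d * a"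
    using norm_triangle_ineq[of "deriv w z * h z" "deriv h z * w z"]
    by (simp add: DERIV_imp_deriv norm_mult a_def d_def)
  also have "cmod (deriv w z) * cmod (h z) \<le> cmod (deriv w z) * (r * (1 + r) * d)"
    using convex_map_quotient_bound[OF h z1]
    by (intro mult_left_mono) (auto simp: r_def d_def)
  also have "\<dots> = (cmod (deriv w z) * (1 - r\<^sup>2)) * (r / (1 - r) * d)"
    using r by (simp add: field_simps power2_eq_square)
  also have "\<dots> \<le> (1 - a\<^sup>2) * (r / (1 - r) * d)"
    using Schwarz_Pick[OF w z1] r d by (intro mult_right_mono) (auto simp: r_def a_def)
  also have "\<dots> < (1 - a\<^sup>2) * (1 / 2 * d)"
  proof -
    have "r / (1 - r) < 1 / 2" using r by (simp add: field_simps)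
    moreover have "1 - a\<^sup>2 > 0" using a by (simp add: abs_square_less_1)
    ultimately show ?thesis using d by (intro mult_strict_left_mono mult_strict_right_mono)
  qed
  also have "(1 - a\<^sup>2) * (1 / 2 * d) + d * a \<le> d"
  proof -
    have "0 \<le> d * (1 - a)\<^sup>2" using d by simp
    moreover have "d - ((1 - a\<^sup>2) * (1 / 2 * d) + d * a) = d * (1 - a)\<^sup>2 / 2"
      by (simp add: power2_eq_square field_simps)
    ultimately show ?thesis by linarith
  qed
  finally show ?thesis by (simp add: d_def)
qed

text \<open>
  If \<open>u\<close> and \<open>v\<close> have the same image, then \<open>|G u - G v| = |u - v|\<close>. But \<open>|G'|\<close> attains a maximum
  below \<open>1\<close> on the compact segment from \<open>u\<close> to \<open>v\<close>, so \<open>G\<close> contracts the distance between distinct points.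
\<close>
lemma inj_on_add_cnj_contraction:
  assumes U: "convex U" "open U" and G: "G holomorphic_on U"
    and G': "\<And>u. u \<in> U \<Longrightarrow> cmod (deriv G u) < 1"
  shows "inj_on (\<lambda>u. u + cnj (G u)) U"
proof (rule inj_onI, rule ccontr)
  fix u v assume uv: "u \<in> U" "v \<in> U" "u + cnj (G u) = v + cnj (G v)" "u \<noteq> v"
  let ?S = "closed_segment u v"
  have S: "?S \<subseteq> U" using uv U by (simp add: closed_segment_subset)
  have "continuous_on ?S (\<lambda>u. cmod (deriv G u))"
    using G U S holomorphic_deriv holomorphic_on_imp_continuous_on continuous_on_subset
      continuous_on_norm by blast
  then obtain m where m: "m \<in> ?S" "\<And>s. s \<in> ?S \<Longrightarrow> cmod (deriv G s) \<le> cmod (deriv G m)"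
    using continuous_attains_sup[of ?S "\<lambda>u. cmod (deriv G u)"] by auto
  have "cmod (G v - G u) \<le> cmod (deriv G m) * cmod (v - u)"
    by (rule field_differentiable_bound[of ?S G "deriv G"])
      (use S m in \<open>auto intro: holomorphic_derivI[OF G U(2)] has_field_derivative_at_within\<close>)
  also have "\<dots> < 1 * cmod (v - u)"
    using uv G'[of m] m(1) S by (intro mult_strict_right_mono) auto
  also have "v - u = cnj (G u - G v)" using uv(3) by (simp add: algebra_simps)
  finally show False by (simp add: norm_minus_commute flip: complex_cnj_diff)
qed

text \<open>
  With \<open>k\<close> the inverse of \<open>h\<close>, the map is \<open>(\<lambda>u. u + cnj (G u)) \<circ> h\<close> for \<open>G = g \<circ> k\<close>, whose
  derivative is \<open>g' / h'\<close>; and \<open>h(D_r)\<close> is convex by Study's theorem.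
\<close>
lemma convex_map_add_cnj_injective:
  assumes h: "convex_map h" "h 0 = 0" and g: "g holomorphic_on ball 0 1" and r: "r \<le> 1"
    and lt: "\<And>z. cmod z < r \<Longrightarrow> cmod (deriv g z) < cmod (deriv h z)"
  shows "inj_on (\<lambda>z. h z + cnj (g z)) (ball 0 r)"
proof -
  obtain k where k: "k holomorphic_on h ` ball 0 1" "\<And>z. z \<in> ball 0 1 \<Longrightarrow> k (h z) = z"
    and k': "\<And>z. z \<in> ball 0 1 \<Longrightarrow> deriv h z * deriv k (h z) = 1"
    using convex_map_inverse[OF h(1)] by blast
  have sub: "ball 0 r \<subseteq> ball (0::complex) 1" using r by auto
  have img: "k ` h ` ball 0 1 \<subseteq> ball 0 1" using k(2) by auto
  have hol: "(g \<circ> k) holomorphic_on h ` ball 0 1"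
    by (rule holomorphic_on_compose_gen[OF k(1) g img])
  have "inj_on (\<lambda>u. u + cnj ((g \<circ> k) u)) (h ` ball 0 r)"
  proof (rule inj_on_add_cnj_contraction)
    show "(g \<circ> k) holomorphic_on h ` ball 0 r"
      using hol sub by (meson holomorphic_on_subset image_mono)
    fix u assume "u \<in> h ` ball 0 r"
    then obtain z where z: "cmod z < r" "u = h z" by auto
    then have z1: "z \<in> ball 0 1" using r by simp
    have dk: "(k has_field_derivative deriv k u) (at u)"
      using holomorphic_derivI[OF k(1) convex_map_open_image[OF h(1) order_refl]] z(2) z1 by blast
    have dg: "(g has_field_derivative deriv g z) (at (k u))"
      using holomorphic_derivI[OF g, of z] z1 k(2)[OF z1] z(2) by simp
    have "deriv (g \<circ> k) u = deriv g z * deriv k u"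
      by (rule DERIV_imp_deriv[OF DERIV_chain[OF dg dk]])
    also have "deriv k u = 1 / deriv h z"
      using k'[OF z1] z z1 convex_map_regular[OF h(1), of z]
      by (simp add: nonzero_eq_divide_eq mult.commute)
    finally show "cmod (deriv (g \<circ> k) u) < 1"
      using lt[OF z(1)] by (auto simp: norm_divide divide_less_eq_1 simp del: o_apply)
  qed (use convex_map_image_ball_convex[OF h r] convex_map_open_image[OF h(1) r] in auto)
  moreover have "inj_on h (ball 0 r)"
    using h(1) sub inj_on_subset unfolding convex_map_def by blast
  ultimately have "inj_on ((\<lambda>u. u + cnj ((g \<circ> k) u)) \<circ> h) (ball 0 r)"
    by (rule comp_inj_on[rotated])
  then show ?thesis
    by (rule inj_on_cong[THEN iffD1, rotated]) (use k(2) sub in auto)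
qed

section \<open>The extremal example\<close>

lemma half_plane_map_convex: "convex_map (\<lambda>z. z / (1 - z))"
proof -
  have n1: "1 - z \<noteq> 0" if "z \<in> ball 0 1" for z :: complex
    using that by (auto simp: right_minus_eq)
  have "(\<lambda>z. z / (1 - z)) ` ball 0 1 = {u. Re u > - (1/2)}"
  proof (intro equalityI subsetI)
    fix u :: complex assume "u \<in> (\<lambda>z. z / (1 - z)) ` ball 0 1"
    then obtain z where z: "cmod z < 1" "u = z / (1 - z)" by auto
    have "2 * u + 1 = (1 + z) / (1 - z)"
      unfolding z(2) using n1[of z] z(1) by (simp add: field_simps)
    moreover have "Re ((1 + z) / (1 - z)) > 0"
    proof -
      have "(Re z)\<^sup>2 + (Im z)\<^sup>2 < 1"
        using z(1) unfolding cmod_power2[symmetric] by (simp add: abs_square_less_1)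
      moreover have "(Re (1 - z))\<^sup>2 + (Im (1 - z))\<^sup>2 > 0"
        using n1[of z] z(1) by (metis cmod_power2 mem_ball_0 zero_less_norm_iff zero_less_power)
      ultimately show ?thesis
        unfolding Re_divide by (intro divide_pos_pos) (auto simp: algebra_simps power2_eq_square)
    qed
    ultimately have "Re (2 * u + 1) > 0" by simp
    then show "u \<in> {u. Re u > - (1/2)}" by simp
  next
    fix u :: complex assume "u \<in> {u. Re u > - (1/2)}"
    then have u: "Re u > - (1/2)" by simp
    have nz: "1 + u \<noteq> 0" using u by (auto simp: complex_eq_iff)
    have "(cmod u)\<^sup>2 < (cmod (1 + u))\<^sup>2"
      unfolding cmod_power2 using u by (simp add: power2_eq_square algebra_simps)
    then have "cmod u < cmod (1 + u)" by (rule power2_less_imp_less) simp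
    then have "u / (1 + u) \<in> ball 0 1"
      using nz by (simp add: norm_divide)
    moreover have "u = (u / (1 + u)) / (1 - u / (1 + u))"
      using nz by (simp add: field_simps)
    ultimately show "u \<in> (\<lambda>z. z / (1 - z)) ` ball 0 1" by blast
  qed
  moreover have "inj_on (\<lambda>z::complex. z / (1 - z)) (ball 0 1)"
    using n1 by (intro inj_onI) (simp add: field_simps)
  ultimately show ?thesis
    unfolding convex_map_def using n1 convex_halfspace_Re_gt
    by (auto intro!: holomorphic_intros)
qed

text \<open>
  The quotient \<open>g' / h'\<close> at \<open>-s\<close> exceeds \<open>1\<close> exactly if \<open>(1 - s) (1 + a s) < (1 + a) s (1 + s)\<close>, that is, if
  \<open>a > (1 - 2 s - s\<^sup>2) / (2 s\<^sup>2)\<close>. For \<open>s > 1/3\<close> this threshold is below \<open>1\<close>, and the chosen \<open>a\<close> is the midpoint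
  between the threshold and \<open>1\<close>, which happens to be a square.
\<close>
lemma half_plane_map_sharpness:
  fixes s :: real
  assumes s: "1/3 < s" "s < 1"
  defines "a \<equiv> ((1 - s) / (2 * s))\<^sup>2"
  shows "0 \<le> a" "a < 1"
    and "harmonic_jacobian (\<lambda>z. z / (1 - z))
      (\<lambda>z. - Moebius_function 0 (of_real a) z * (z / (1 - z))) (- of_real s) < 0"
proof -
  show a0: "0 \<le> a" by (simp add: a_def)
  have "\<bar>(1 - s) / (2 * s)\<bar> < 1" using s by (simp add: field_simps)
  then show a1: "a < 1" unfolding a_def by (simp only: abs_square_less_1)
  let ?z = "- of_real s :: complex"
  have as: "1 + a * s > 0" using a0 s by (simp add: add_pos_nonneg)
  have e1: "1 - cnj (of_real a) * ?z = of_real (1 + a * s)" by simp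
  have e2: "1 - ?z = of_real (1 + s)" by simp
  have dh: "((\<lambda>z. z / (1 - z)) has_field_derivative of_real (1 / (1 + s)\<^sup>2)) (at ?z)"
  proof -
    have "1 - ?z \<noteq> 0" unfolding e2 of_real_eq_0_iff using s by simp
    then have "((\<lambda>z. z / (1 - z)) has_field_derivative 1 / (1 - ?z)\<^sup>2) (at ?z)"
      by (auto intro!: derivative_eq_intros simp: power2_eq_square field_simps)
    then show ?thesis unfolding e2 by simp
  qed
  have "1 - cnj (of_real a) * ?z \<noteq> 0"
    unfolding e1 of_real_eq_0_iff using as by simp
  from Moebius_function_has_derivative[OF this]
  have dM: "(Moebius_function 0 (of_real a) has_field_derivative
      of_real ((1 - a\<^sup>2) / (1 + a * s)\<^sup>2)) (at ?z)"
    unfolding e1 by simp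
  have e3: "?z - of_real a = - of_real (a + s)" by simp
  have M: "- Moebius_function 0 (of_real a) ?z = of_real ((a + s) / (1 + a * s))"
    unfolding Moebius_function_simple e1 e3 by (simp only: divide_minus_left minus_minus of_real_divide)
  have hz: "?z / (1 - ?z) = of_real (- s / (1 + s))"
    unfolding e2 by simp
  \<comment> \<open>the derivative of the product at \<open>-s\<close>, which is real\<close>
  define P where "P = (1 - a\<^sup>2) / (1 + a * s)\<^sup>2 * (s / (1 + s))
      + (a + s) / (1 + a * s) * (1 / (1 + s)\<^sup>2)"
  have "((\<lambda>z. - Moebius_function 0 (of_real a) z * (z / (1 - z))) has_field_derivative
      of_real P) (at ?z)"
    by (rule DERIV_cong[OF DERIV_mult[OF DERIV_minus[OF dM] dh]])
      (unfold M hz, simp add: P_def mult.commute)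
  then have dg: "deriv (\<lambda>z. - Moebius_function 0 (of_real a) z * (z / (1 - z))) ?z = of_real P"
    by (rule DERIV_imp_deriv)
  have dh': "deriv (\<lambda>z. z / (1 - z)) ?z = of_real (1 / (1 + s)\<^sup>2)"
    using dh by (rule DERIV_imp_deriv)
  have key: "(1 - s) * (1 + a * s) < (1 + a) * s * (1 + s)"
  proof -
    have "2 * a * s\<^sup>2 = (1 - s)\<^sup>2 / 2"
      using s by (simp add: a_def power_divide field_simps)
    moreover have "(3 * s - 1) * (s + 1) > 0" using s by simp
    ultimately show ?thesis by (simp add: algebra_simps power2_eq_square)
  qed
  have "P - 1 / (1 + s)\<^sup>2 = (1 - a) * ((1 + a) * s * (1 + s) - (1 - s) * (1 + a * s))
      / ((1 + a * s)\<^sup>2 * (1 + s)\<^sup>2)"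
    using as s unfolding P_def by (simp add: divide_simps) (simp add: algebra_simps power2_eq_square)
  also have "\<dots> > 0"
    using as s a1 key by (intro divide_pos_pos mult_pos_pos) auto
  finally have "1 / (1 + s)\<^sup>2 < P" by simp
  then have "(1 / (1 + s)\<^sup>2)\<^sup>2 < P\<^sup>2"
    by (intro power_strict_mono) auto
  then show "harmonic_jacobian (\<lambda>z. z / (1 - z))
      (\<lambda>z. - Moebius_function 0 (of_real a) z * (z / (1 - z))) (- of_real s) < 0"
    unfolding harmonic_jacobian_def dg dh' by (simp only: norm_of_real power2_abs)
qed

theorem theorem2p1:
  shows "(\<forall>f h g w.
            Har_rep f h g \<and> convex_map h \<and> w \<in> bounded_class \<and> \<not> unimodular_const w \<and>
            (\<forall>z\<in>ball 0 1. g z = w z * h z)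
            \<longrightarrow> sense_preserving_on h g (ball 0 (1/3)) \<and> inj_on f (ball 0 (1/3)))
       \<and> (\<forall>r::real. 1/3 < r \<and> r \<le> 1 \<longrightarrow>
            (\<exists>f h g w.
               Har_rep f h g \<and> convex_map h \<and> w \<in> bounded_class \<and> \<not> unimodular_const w \<and>
               (\<forall>z\<in>ball 0 1. g z = w z * h z) \<and>
               \<not> (sense_preserving_on h g (ball 0 r) \<and> inj_on f (ball 0 r))))"
proof ((rule conjI; intro allI impI), goal_cases)
  case (1 f h g w)
  then have h: "convex_map h" "h 0 = 0" by (auto simp: Har_rep_def)
  have lt: "cmod (deriv g z) < cmod (deriv h z)" if "cmod z < 1 / 3" for z
  proof (rule deriv_product_less_deriv[OF h _ _ _ that])
    show "w holomorphic_on ball 0 1" using 1 by (simp add: bounded_class_def)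
    show "cmod (w z) < 1" if "cmod z < 1" for z
      using bounded_class_norm_less_1 1 that by blast
  qed (use 1 in auto)
  then have "sense_preserving_on h g (ball 0 (1/3))"
    by (auto simp: sense_preserving_on_def harmonic_jacobian_def intro!: power_strict_mono)
  moreover have "inj_on (\<lambda>z. h z + cnj (g z)) (ball 0 (1/3))"
    using 1 by (intro convex_map_add_cnj_injective[OF h] lt) (auto simp: Har_rep_def)
  then have "inj_on f (ball 0 (1/3))"
    by (rule inj_on_cong[THEN iffD1, rotated]) (use 1 in \<open>auto simp: Har_rep_def\<close>)
  ultimately show ?case ..
next
  case (2 r)
  define s where "s = (1 / 3 + r) / 2"
  have s: "1/3 < s" "s < 1" "s < r" using 2 by (auto simp: s_def)
  define a where "a = ((1 - s) / (2 * s))\<^sup>2"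
  note sharp = half_plane_map_sharpness[OF s(1,2), folded a_def]
  define h :: "complex \<Rightarrow> complex" where "h = (\<lambda>z. z / (1 - z))"
  define w where "w = (\<lambda>z. - Moebius_function 0 (of_real a) z)"
  define g where "g = (\<lambda>z. w z * h z)"
  have h: "convex_map h" unfolding h_def by (rule half_plane_map_convex)
  have a: "cmod (of_real a) < 1" using sharp by simp
  have holw: "w holomorphic_on ball 0 1"
    unfolding w_def by (intro holomorphic_intros Moebius_function_holomorphic a)
  have w1: "cmod (w z) < 1" if "cmod z < 1" for z
    using Moebius_function_norm_lt_1[OF a that, of 0] by (simp add: w_def)
  have "(h has_field_derivative 1) (at 0)"
    unfolding h_def by (auto intro!: derivative_eq_intros)
  then have "deriv h 0 = 1" by (rule DERIV_imp_deriv)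
  moreover have "g holomorphic_on ball 0 1"
    unfolding g_def using h holw by (auto simp: convex_map_def intro!: holomorphic_intros)
  ultimately have "Har_rep (\<lambda>z. h z + cnj (g z)) h g"
    using h by (auto simp: Har_rep_def convex_map_def) (auto simp: g_def h_def)
  moreover have "w \<in> bounded_class"
    using holw w1 by (auto simp: bounded_class_def less_imp_le)
  moreover have "\<not> unimodular_const w"
    using w1[of 0] unfolding unimodular_const_def
    by (metis centre_in_ball less_irrefl norm_zero zero_less_one)
  moreover have "\<not> sense_preserving_on h g (ball 0 r)"
  proof
    assume "sense_preserving_on h g (ball 0 r)"
    moreover have "- of_real s \<in> ball (0::complex) r" using s by simp
    ultimately have "harmonic_jacobian h g (- of_real s) > 0"
      unfolding sense_preserving_on_def by blast
    with sharp(3) show False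
      by (simp add: h_def g_def w_def)
  qed
  ultimately show ?case
    using h g_def by blast
qed

end
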